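(* Let $\phi = \frac{1+\sqrt{5}}{2}$ be the golden ratio. Let $x, y \in \mathbb{N}$ with $x > y \geq 0$. Then the number $m$ of (recursive) iterations performed by the Euclidean Algorithm on input $(x,y)$ satisfies $$m \leq \log_{\phi}(\phi x + y).$$
   Context: Here $\mathbb{N}$ denotes the non-negative integers. The Euclidean Algorithm takes as input two non-negative integers $x > y$ and computes $\gcd(x,y)$ as follows: if $y = 0$, return $x$; if $y = 1$, return $1$; otherwise recursively return $\gcd(y, x \bmod y)$, where $x \bmod y \in \{0,\dots,y-1\}$ is the remainder of $x$ on division by $y$. The number $m$ of iterations is the total number of calls, including the initial call and the final call that returns without recursing. Equivalently: set $x_1 = x$, $y_1 = y$, and as long as $y_i \geq 2$ set $x_{i+1} = y_i$, $y_{i+1} = x_i \bmod y_i$; then $m$ is the index $i \ge 1$ at which $y_i \in \{0,1\}$ first occurs. *)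

theory Defs
  imports Complex_Main
begin

definition golden_ratio :: real
  where "golden_ratio = (1 + sqrt 5) / 2"

(* The second component counts the calls: the initial one and the final,
   non-recursing one are both included. *)
function euclid :: "nat \<Rightarrow> nat \<Rightarrow> nat \<times> nat" where
  "euclid x y =
     (if y = 0 then (x, 1)
      else if y = 1 then (1, 1)
      else (let (g, m) = euclid y (x mod y) in (g, Suc m)))"
  by pat_completeness auto
termination by (relation "measure snd") auto

declare euclid.simps [simp del]

definition euclid_iterations :: "nat \<Rightarrow> nat \<Rightarrow> nat"
  where "euclid_iterations x y = snd (euclid x y)"

lemma fst_euclid: "fst (euclid x y) = gcd x y"
proof (induction x y rule: euclid.induct)
  case (1 x y)
  show ?case
  proof (cases "y = 0 \<or> y = 1")
    case True
    then show ?thesis by (auto simp: euclid.simps[of x y])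
  next
    case False
    then have "fst (euclid y (x mod y)) = gcd y (x mod y)" using 1 by simp
    moreover have "gcd y (x mod y) = gcd x y" by (metis gcd_red_nat)
    ultimately show ?thesis using False
      by (simp add: euclid.simps[of x y] case_prod_beta)
  qed
qed

lemma euclid_iterations_rec:
  "euclid_iterations x y =
     (if y \<le> 1 then 1 else Suc (euclid_iterations y (x mod y)))"
  by (simp add: euclid_iterations_def euclid.simps[of x y] case_prod_beta)

end

theory Submission
  imports Defs
begin

text \<open>
  The quantity \<open>\<phi> x + y\<close> drops by at least a factor \<open>\<phi>\<close> in each call: if \<open>r\<close> is the remainder
  of \<open>x\<close> modulo \<open>y\<close>, then \<open>\<phi> (\<phi> y + r) = \<phi> (y + r) + y \<le> \<phi> x + y\<close>, since \<open>\<phi>\<^sup>2 = \<phi> + 1\<close> and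
  \<open>y + r \<le> x\<close>.
\<close>

lemma golden_ratio_gt_1: "golden_ratio > 1"
proof -
  have "sqrt 5 > (1 :: real)"
    by simp
  then show ?thesis
    by (simp add: golden_ratio_def)
qed

lemma golden_ratio_square: "golden_ratio * golden_ratio = golden_ratio + 1"
  by (simp add: golden_ratio_def field_simps)

text \<open>Subtracting \<open>y\<close> once does not change the remainder, and a remainder never
  exceeds its dividend \<open>x - y\<close>.\<close>

lemma add_mod_le:
  fixes x y :: nat
  assumes "y \<le> x"
  shows "y + x mod y \<le> x"
proof -
  have "x mod y \<le> x - y"
    using assms by (metis le_mod_geq mod_less_eq_dividend)
  then show ?thesis
    using assms by simp
qed

lemma golden_ratio_power_euclid_iterations_le:
  assumes "y < x"
  shows "golden_ratio ^ euclid_iterations x y \<le> golden_ratio * real x + real y"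
  using assms
proof (induction x y rule: euclid.induct)
  case (1 x y)
  show ?case
  proof (cases "y \<le> 1")
    case True
    \<comment> \<open>The only call counts as 1, so the first power of \<phi> must be bounded;
      \<open>y < x\<close> forces \<open>x\<close> to be at least 1.\<close>
    have "golden_ratio * 1 \<le> golden_ratio * real x"
      using \<open>y < x\<close> golden_ratio_gt_1 by (intro mult_left_mono) auto
    then show ?thesis
      using True by (simp add: euclid_iterations_rec[of x y])
  next
    case False
    define r where "r = x mod y"
    \<comment> \<open>The induction hypothesis applies to \<open>(y, r)\<close> because
      \<open>y > 0\<close> gives \<open>r < y\<close>.\<close>
    have "golden_ratio ^ euclid_iterations y r \<le> golden_ratio * real y + real r"
      using 1 False by (simp add: r_def)
    then have "golden_ratio * golden_ratio ^ euclid_iterations y r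
        \<le> golden_ratio * (golden_ratio * real y + real r)"
      using golden_ratio_gt_1 by (intro mult_left_mono) auto
    also have "\<dots> = (golden_ratio * golden_ratio) * real y + golden_ratio * real r"
      by (simp add: algebra_simps)
    also have "\<dots> = golden_ratio * real (y + r) + real y"
      by (simp only: golden_ratio_square) (simp add: algebra_simps)
    also have "\<dots> \<le> golden_ratio * real x + real y"
      using add_mod_le[of y x] \<open>y < x\<close> golden_ratio_gt_1
      by (intro add_right_mono mult_left_mono) (auto simp: r_def simp del: of_nat_add)
    finally show ?thesis
      using False by (simp add: euclid_iterations_rec[of x y] r_def)
  qed
qed

theorem theorem2:
  fixes x y :: nat
  assumes "x > y" and "y \<ge> 0"
  shows "real (euclid_iterations x y) \<le> log golden_ratio (golden_ratio * real x + real y)"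
  using golden_ratio_power_euclid_iterations_le[OF assms(1)] golden_ratio_gt_1
  by (intro le_log_of_power) auto

end
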